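(* The map $z_o$ from the set of Gauss words to the abelian group $Z_o$ is an open homotopy invariant of Gauss words; that is, if two Gauss words $w_1$ and $w_2$ are open homotopic, then $z_o(w_1)=z_o(w_2)$ in $Z_o$.
   Context: **Gauss words.** An alphabet is a finite set, whose elements are called letters. A word on an alphabet $\mathcal{A}$ is a finite (possibly empty) sequence of letters of $\mathcal{A}$; $\emptyset$ denotes the empty word. A Gauss word on $\mathcal{A}$ is a word in which every letter of $\mathcal{A}$ appears exactly twice (so $\mathcal{A}$ is the set of letters appearing in the word). Gauss words $u$ on $\mathcal{A}$ and $v$ on $\mathcal{B}$ are isomorphic if there is a bijection $f:\mathcal{A}\to\mathcal{B}$ such that $f$ applied letterwise to $u$ gives $v$. **Open homotopy of Gauss words.** Consider the following moves on Gauss words (each may be applied in either direction), where $A,B,C$ are individual (distinct) letters and $t,x,y,z$ are arbitrary, possibly empty, sequences of letters such that both sides are Gauss words: H1: $xAAy \leftrightarrow xy$; H2: $xAByBAz \leftrightarrow xyz$; H3: $xAByACzBCt \leftrightarrow xBAyCAzCBt$. Two Gauss words are open homotopic if one can be transformed into the other by a finite sequence of isomorphisms and moves H1, H2, H3. **Gauss phrases and mixed homotopy.** A $2$-component Gauss phrase is a pair of words $w_1|w_2$ (components, possibly empty) whose concatenation $w_1w_2$ is a Gauss word. Two such phrases $u_1|u_2$ and $v_1|v_2$ are isomorphic if there is a bijection of their alphabets which applied letterwise sends $u_i$ to $v_i$ for $i=1,2$. The moves H1, H2, H3 on Gauss phrases are the following (each may be applied in either direction), where $A,B,C$ are individual (distinct)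 letters and $t,x,y,z$ are arbitrary, possibly empty, sequences of letters which may also contain the separator $|$, such that both sides are $2$-component Gauss phrases: H1: $xAAy \leftrightarrow xy$; H2: $xAByBAz \leftrightarrow xyz$; H3: $xAByACzBCt \leftrightarrow xBAyCAzCBt$; the two-letter subwords $AA$, $AB$, $BA$, $AC$, $CA$, $BC$, $CB$ explicitly displayed in the moves must not be broken by the separator. A shift move on a component replaces a component of the form $Ax$ ($A$ a letter, $x$ a letter sequence) by $xA$, leaving the other component unchanged. Mixed homotopy of $2$-component Gauss phrases is the equivalence relation generated by isomorphisms, the moves H1, H2, H3, and shift moves on the first component only (the first component is "closed", the second is "open"). **The map $z_o$.** Let $\mathcal{GPM}(2)$ be the set of equivalence classes of $2$-component Gauss phrases under mixed homotopy, let $H$ be the free abelian group generated by $\mathcal{GPM}(2)$, let $Z_o=H/2H$, and let $\phi:H\to Z_o$ be the natural homomorphism. For a Gauss word $w$ and a letter $A$ in $w$, write $w=xAyAz$ (with $x,y,z$ sequences of letters) and let $p(w,A)$ be the Gauss phrase $y|xz$; let $u_m(w,A)\in\mathcal{GPM}(2)$ be the mixed homotopy class of $p(w,A)$, and let $t_m(w)\in\mathcal{GPM}(2)$ be the mixed homotopy class of $\emptyset|w$. Define $$h(w)=\sum_{A\in w}\bigl(u_m(w,A)-t_m(w)\bigr)\in H,\qquad z_o(w)=\phi(h(w))\in Z_o,$$ where the sum is over all letters $A$ in the alphabet of $w$ (each letter counted once). *)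

theory Defs
  imports
    "HOL-Algebra.Free_Abelian_Groups"
    "HOL-Library.Infinite_Typeclass"
begin

definition gauss_word :: "'a list \<Rightarrow> bool" where
  "gauss_word w \<longleftrightarrow> (\<forall>A\<in>set w. count_list w A = 2)"

definition word_iso :: "'a list \<Rightarrow> 'a list \<Rightarrow> bool" where
  "word_iso u v \<longleftrightarrow> (\<exists>f. bij_betw f (set u) (set v) \<and> map f u = v)"

text \<open>The move patterns on sequences of symbols. The set \<open>L\<close> says which symbols are letters:
  all of them for words, all except the separator for phrases. The remaining pieces
  \<open>x\<close>, \<open>y\<close>, \<open>z\<close>, \<open>t\<close> are arbitrary sequences of symbols.\<close>

inductive H_move :: "'s set \<Rightarrow> 's list \<Rightarrow> 's list \<Rightarrow> bool" for L where
  H1: "A \<in> L \<Longrightarrow> H_move L (x @ [A, A] @ y) (x @ y)"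
| H2: "{A, B} \<subseteq> L \<Longrightarrow> distinct [A, B] \<Longrightarrow>
        H_move L (x @ [A, B] @ y @ [B, A] @ z) (x @ y @ z)"
| H3: "{A, B, C} \<subseteq> L \<Longrightarrow> distinct [A, B, C] \<Longrightarrow>
        H_move L (x @ [A, B] @ y @ [A, C] @ z @ [B, C] @ t)
                 (x @ [B, A] @ y @ [C, A] @ z @ [C, B] @ t)"

definition open_step :: "'a list \<Rightarrow> 'a list \<Rightarrow> bool" where
  "open_step u v \<longleftrightarrow> gauss_word u \<and> gauss_word v \<and> (word_iso u v \<or> H_move UNIV u v)"

definition open_homotopic :: "'a list \<Rightarrow> 'a list \<Rightarrow> bool" where
  "open_homotopic = equivclp open_step"

type_synonym 'a phrase = "'a list \<times> 'a list"

definition gauss_phrase :: "'a phrase \<Rightarrow> bool" where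
  "gauss_phrase P \<longleftrightarrow> gauss_word (fst P @ snd P)"

definition phrase_iso :: "'a phrase \<Rightarrow> 'a phrase \<Rightarrow> bool" where
  "phrase_iso P Q \<longleftrightarrow>
     (\<exists>f. bij_betw f (set (fst P @ snd P)) (set (fst Q @ snd Q)) \<and>
          map f (fst P) = fst Q \<and> map f (snd P) = snd Q)"

datatype 'a symbol = Letter 'a | Separator

definition symbols :: "'a phrase \<Rightarrow> 'a symbol list" where
  "symbols P = map Letter (fst P) @ [Separator] @ map Letter (snd P)"

inductive shift_first :: "'a phrase \<Rightarrow> 'a phrase \<Rightarrow> bool" where
  "shift_first (A # x, v) (x @ [A], v)"

definition mixed_step :: "'a phrase \<Rightarrow> 'a phrase \<Rightarrow> bool" where
  "mixed_step P Q \<longleftrightarrow> gauss_phrase P \<and> gauss_phrase Q \<and>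
     (phrase_iso P Q \<or> H_move (range Letter) (symbols P) (symbols Q) \<or> shift_first P Q)"

definition mixed_homotopy :: "('a phrase \<times> 'a phrase) set" where
  "mixed_homotopy = {(P, Q). gauss_phrase P \<and> gauss_phrase Q \<and> equivclp mixed_step P Q}"

definition GPM2 :: "'a phrase set set" where
  "GPM2 = {P. gauss_phrase P} // mixed_homotopy"

definition mixed_class :: "'a phrase \<Rightarrow> 'a phrase set" where
  "mixed_class P = mixed_homotopy `` {P}"

definition H_group :: "('a phrase set \<Rightarrow>\<^sub>0 int) monoid" where
  "H_group = free_Abelian_group GPM2"

definition two_H :: "('a phrase set \<Rightarrow>\<^sub>0 int) set" where
  "two_H = (\<lambda>c. c [^]\<^bsub>H_group\<^esub> (2::nat)) ` carrier H_group"

definition Zo_group :: "('a phrase set \<Rightarrow>\<^sub>0 int) set monoid" where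
  "Zo_group = H_group Mod two_H"

definition phi :: "('a phrase set \<Rightarrow>\<^sub>0 int) \<Rightarrow> ('a phrase set \<Rightarrow>\<^sub>0 int) set" where
  "phi c = two_H #>\<^bsub>H_group\<^esub> c"

definition p :: "'a list \<Rightarrow> 'a \<Rightarrow> 'a phrase" where
  "p w A = (THE P. \<exists>x y z. w = x @ [A] @ y @ [A] @ z \<and> P = (y, x @ z))"

definition u_m :: "'a list \<Rightarrow> 'a \<Rightarrow> 'a phrase set" where
  "u_m w A = mixed_class (p w A)"

definition t_m :: "'a list \<Rightarrow> 'a phrase set" where
  "t_m w = mixed_class ([], w)"

text \<open>The group operation of \<^const>\<open>free_Abelian_group\<close> is the addition of
  \<^typ>\<open>'b \<Rightarrow>\<^sub>0 int\<close>, so the sum and difference below are those of \<^const>\<open>H_group\<close>.\<close>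

definition h :: "'a list \<Rightarrow> ('a phrase set \<Rightarrow>\<^sub>0 int)" where
  "h w = (\<Sum>A\<in>set w. frag_of (u_m w A) - frag_of (t_m w))"

definition z_o :: "'a list \<Rightarrow> ('a phrase set \<Rightarrow>\<^sub>0 int) set" where
  "z_o w = phi (h w)"


text \<open>The description in \<^const>\<open>p\<close> is unambiguous, and the objects above live where they should.\<close>

lemma gauss_word_split:
  assumes "gauss_word w" "A \<in> set w"
  obtains x y z where "w = x @ [A] @ y @ [A] @ z" "A \<notin> set x" "A \<notin> set y" "A \<notin> set z"
proof -
  obtain x r where r: "w = x @ A # r" "A \<notin> set x"
    using assms(2) split_list_first by fastforce
  have c: "count_list w A = 2"
    using assms unfolding gauss_word_def by blast
  with r have cr: "count_list r A = 1"
    by simp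
  then have "A \<in> set r"
    using count_notin by fastforce
  then obtain y z where yz: "r = y @ A # z" "A \<notin> set y"
    using split_list_first by fastforce
  with cr have "count_list z A = 0"
    by simp
  then have "A \<notin> set z"
    by (simp add: count_list_0_iff)
  with r yz show thesis
    by (intro that[of x y z]) auto
qed

lemma p_eq:
  assumes "gauss_word (x @ [A] @ y @ [A] @ z)"
  shows "p (x @ [A] @ y @ [A] @ z) A = (y, x @ z)"
proof -
  have uniq: "A \<notin> set x' \<and> A \<notin> set y'"
    if "x @ [A] @ y @ [A] @ z = x' @ [A] @ y' @ [A] @ z'" for x' y' z'
  proof -
    have "count_list (x' @ [A] @ y' @ [A] @ z') A = 2"
      using assms unfolding that gauss_word_def by auto
    then show ?thesis
      by (auto simp: count_list_0_iff)
  qed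
  have "x' = x \<and> y' = y \<and> z' = z"
    if eq: "x @ [A] @ y @ [A] @ z = x' @ [A] @ y' @ [A] @ z'" for x' y' z'
  proof -
    have split: "us = us' \<and> vs = vs'"
      if "us @ A # vs = us' @ A # vs'" "A \<notin> set us" "A \<notin> set us'" for us vs us' vs'
      using that
    proof (induction us arbitrary: us')
      case Nil
      then show ?case by (cases us') auto
    next
      case (Cons u us)
      then show ?case by (cases us') auto
    qed
    have "x = x' \<and> y @ A # z = y' @ A # z'"
      by (rule split) (use uniq[OF refl] uniq[OF eq] eq in auto)
    moreover from this have "y = y' \<and> z = z'"
      by (intro split) (use uniq[OF refl] uniq[OF eq] in auto)
    ultimately show ?thesis
      by simp
  qed
  then show ?thesis
    unfolding p_def by (intro the_equality) blast+
qed

lemma gauss_phrase_p: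
  assumes "gauss_word w" "A \<in> set w"
  shows "gauss_phrase (p w A)"
proof -
  obtain x y z where w: "w = x @ [A] @ y @ [A] @ z"
    and n: "A \<notin> set x" "A \<notin> set y" "A \<notin> set z"
    using gauss_word_split assms by metis
  have "count_list (y @ x @ z) B = 2" if "B \<in> set (y @ x @ z)" for B
  proof -
    have "B \<noteq> A" "B \<in> set w"
      using that n w by auto
    then have "count_list w B = 2" and "B \<noteq> A"
      using assms(1) unfolding gauss_word_def by auto
    then show ?thesis
      by (simp add: w)
  qed
  moreover have "p w A = (y, x @ z)"
    using p_eq assms(1) unfolding w by fast
  ultimately show ?thesis
    by (simp add: gauss_phrase_def gauss_word_def)
qed

lemma equiv_mixed_homotopy: "equiv {P. gauss_phrase P} mixed_homotopy"
proof (rule equivI)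
  show "refl_on {P. gauss_phrase P} mixed_homotopy"
    by (auto simp: refl_on_def mixed_homotopy_def)
  show "sym mixed_homotopy"
    by (auto simp: sym_def mixed_homotopy_def intro: equivclp_sym)
  show "trans mixed_homotopy"
    by (auto simp: trans_def mixed_homotopy_def intro: equivclp_trans)
qed (auto simp: mixed_homotopy_def)

lemma comm_group_H_group: "comm_group H_group"
  by (simp add: H_group_def abelian_free_Abelian_group)

lemma subgroup_two_H: "subgroup two_H (H_group :: ('a phrase set \<Rightarrow>\<^sub>0 int) monoid)"
proof -
  interpret comm_group "H_group :: ('a phrase set \<Rightarrow>\<^sub>0 int) monoid"
    by (rule comm_group_H_group)
  show ?thesis
  proof (rule subgroupI)
    fix a :: "'a phrase set \<Rightarrow>\<^sub>0 int"
    assume "a \<in> two_H"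
    then obtain c where c: "c \<in> carrier H_group" "a = c [^]\<^bsub>H_group\<^esub> (2::nat)"
      by (auto simp: two_H_def)
    then have "inv\<^bsub>H_group\<^esub> a = (inv\<^bsub>H_group\<^esub> c) [^]\<^bsub>H_group\<^esub> (2::nat)"
      by (simp add: nat_pow_inv)
    with c show "inv\<^bsub>H_group\<^esub> a \<in> two_H"
      by (auto simp: two_H_def)
  next
    fix a b :: "'a phrase set \<Rightarrow>\<^sub>0 int"
    assume "a \<in> two_H" "b \<in> two_H"
    then obtain c d where "c \<in> carrier H_group" "a = c [^]\<^bsub>H_group\<^esub> (2::nat)"
      "d \<in> carrier H_group" "b = d [^]\<^bsub>H_group\<^esub> (2::nat)"
      by (auto simp: two_H_def)
    then show "a \<otimes>\<^bsub>H_group\<^esub> b \<in> two_H"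
      by (auto simp: two_H_def m_comm simp flip: pow_mult_distrib)
  qed (auto simp: two_H_def)
qed

lemma comm_group_Zo_group: "comm_group Zo_group"
  unfolding Zo_group_def
  by (rule comm_group.abelian_FactGroup[OF comm_group_H_group subgroup_two_H])

lemma phi_hom: "phi \<in> hom H_group Zo_group"
proof -
  have "two_H \<lhd> H_group"
    using comm_group.normal_iff_subgroup[OF comm_group_H_group] subgroup_two_H by blast
  from normal.r_coset_hom_Mod[OF this] show ?thesis
    by (simp add: Zo_group_def phi_def[abs_def])
qed

lemma h_in_H_group:
  fixes w :: "'a list"
  assumes g: "gauss_word w"
  shows "h w \<in> carrier H_group"
proof -
  have cl: "mixed_class P \<in> GPM2" if "gauss_phrase P" for P :: "'a phrase"
    using that by (simp add: GPM2_def mixed_class_def quotientI)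
  have "frag_of (u_m w A) - frag_of (t_m w) \<in> carrier (free_Abelian_group GPM2)"
    if "A \<in> set w" for A
  proof -
    have "u_m w A \<in> GPM2" "t_m w \<in> GPM2"
      using g gauss_phrase_p[OF g that] cl by (auto simp: u_m_def t_m_def gauss_phrase_def)
    then show ?thesis
      using keys_diff[of "frag_of (u_m w A)" "frag_of (t_m w)"]
      by (auto)
  qed
  then show ?thesis
    unfolding h_def H_group_def by (rule sum_closed_free_Abelian_group)
qed

lemma z_o_in_Zo_group: "gauss_word w \<Longrightarrow> z_o w \<in> carrier Zo_group"
  using hom_in_carrier[OF phi_hom] h_in_H_group by (auto simp: z_o_def)

end

theory Submission
  imports Defs "HOL-Library.Multiset" "HOL-Combinatorics.Transposition"
begin

text \<open>
  The phrase \<open>p w D\<close> is obtained from \<open>w = x D y D z\<close> by cutting out \<open>y\<close>, making it the closed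
  first component, and splicing \<open>x\<close> and \<open>z\<close> together. A move on \<open>w\<close> changes only two-letter sites;
  so for a letter \<open>D\<close> outside the sites, the phrases before and after the move carry the same
  sites, in a possibly different order, and must be shown to be mixed homotopic. For H1 and H2
  the order does not matter, because H2 is symmetric in its two letters. H3 is not symmetric:
  when the sites \<open>AB\<close>, \<open>AC\<close>, \<open>BC\<close> are read in another order, one gets, up to renaming, one of
  the variants of H3 in which some sites are reversed. All of these variants, as well as the
  parallel version \<open>xAByABz \<leftrightarrow> xyz\<close> of H2, follow from the three given moves, at the
  price of auxiliary fresh letters (\<open>H2_parallel_delete\<close>, \<open>H3_any_orientation\<close>). This is where the
  infinite supply of letters enters. Hence \<open>t_m\<close> is unchanged, and so is \<open>u_m\<close> at every letter
  that is not displayed in the move (\<open>uninvolved_letters\<close>).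

  It remains to look at the displayed letters. In H1, cutting at \<open>A\<close> gives \<open>\<emptyset>|xy\<close>, so the summand
  of \<open>A\<close> is \<open>t_m - t_m = 0\<close>. In H2 the phrases \<open>ByB|xz\<close> and \<open>y|xAAz\<close> of \<open>A\<close> and \<open>B\<close> both reduce to
  \<open>y|xz\<close>, one of them after a shift, so together they contribute twice an element of \<open>H\<close>; this is
  why the invariant lives in \<open>H/2H\<close>. In H3 the two phrases of each of \<open>A\<close>, \<open>B\<close>, \<open>C\<close> agree: for \<open>A\<close>
  and \<open>C\<close> by a shift and a renaming, and for \<open>B\<close> because the phrases \<open>yACz|xACt\<close> and \<open>AyCAzC|xt\<close>
  both reduce to \<open>yz|xt\<close> by the parallel version of H2, the second one after a shift. Thus H1, H3
  and isomorphisms preserve even \<open>h\<close>, and H2 preserves it modulo \<open>2H\<close>.\<close>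

section \<open>Move equivalence of symbol sequences\<close>

text \<open>Only the letters in \<open>L\<close> are counted, so that the same notion applies to words and to
  phrases written with a separator, on whose number of occurrences no condition is imposed.\<close>

definition doubled :: "'s set \<Rightarrow> 's list \<Rightarrow> bool" where
  "doubled L s \<longleftrightarrow> (\<forall>A\<in>L. count_list s A = 0 \<or> count_list s A = 2)"

definition move_equiv :: "'s set \<Rightarrow> 's list \<Rightarrow> 's list \<Rightarrow> bool" where
  "move_equiv L u v \<longleftrightarrow> doubled L u \<and> doubled L v \<and>
     equivclp (\<lambda>u v. doubled L u \<and> doubled L v \<and> H_move L u v) u v"

lemma move_equiv_sym: "move_equiv L u v \<Longrightarrow> move_equiv L v u"
  by (auto simp: move_equiv_def intro: equivclp_sym)

lemma move_equiv_trans [trans]: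
  "move_equiv L u v \<Longrightarrow> move_equiv L v w \<Longrightarrow> move_equiv L u w"
  by (auto simp: move_equiv_def intro: equivclp_trans)

lemma move_equiv_doubled: "move_equiv L u v \<Longrightarrow> doubled L v"
  by (simp add: move_equiv_def)

lemma H_move_imp_move_equiv:
  "H_move L u v \<Longrightarrow> doubled L u \<Longrightarrow> doubled L v \<Longrightarrow> move_equiv L u v"
  by (auto simp: move_equiv_def)

text \<open>Only this direction is unconditional: H1 and H2 read from right to left introduce letters
  that may already be in use.\<close>

lemma H_move_doubled: "H_move L u v \<Longrightarrow> doubled L u \<Longrightarrow> doubled L v"
proof (induction rule: H_move.induct)
  case (H1 A x y)
  show ?case
    unfolding doubled_def
  proof
    fix S assume "S \<in> L"
    with H1(2) have "count_list (x @ [A, A] @ y) S = 0 \<or> count_list (x @ [A, A] @ y) S = 2"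
      unfolding doubled_def by blast
    then show "count_list (x @ y) S = 0 \<or> count_list (x @ y) S = 2"
      by (auto split: if_splits)
  qed
next
  case (H2 A B x y z)
  show ?case
    unfolding doubled_def
  proof
    fix S assume "S \<in> L"
    with H2(3) have "count_list (x @ [A, B] @ y @ [B, A] @ z) S = 0 \<or>
      count_list (x @ [A, B] @ y @ [B, A] @ z) S = 2"
      unfolding doubled_def by blast
    then show "count_list (x @ y @ z) S = 0 \<or> count_list (x @ y @ z) S = 2"
      by (auto split: if_splits)
  qed
next
  case (H3 A B C x y z t)
  have "count_list (x @ [A, B] @ y @ [A, C] @ z @ [B, C] @ t) S =
        count_list (x @ [B, A] @ y @ [C, A] @ z @ [C, B] @ t) S" for S
    by simp
  then show ?case
    using H3(3) unfolding doubled_def by metis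
qed

lemma H1_delete:
  assumes "doubled L (x @ [A, A] @ y)" "A \<in> L"
  shows "move_equiv L (x @ [A, A] @ y) (x @ y)"
  using H_move.H1[OF assms(2), of x y] assms(1) H_move_doubled H_move_imp_move_equiv by metis

lemma H2_delete:
  assumes "doubled L (x @ [A, B] @ y @ [B, A] @ z)" "A \<in> L" "B \<in> L" "A \<noteq> B"
  shows "move_equiv L (x @ [A, B] @ y @ [B, A] @ z) (x @ y @ z)"
proof -
  have "H_move L (x @ [A, B] @ y @ [B, A] @ z) (x @ y @ z)"
    using assms by (intro H_move.H2) auto
  then show ?thesis
    using assms(1) H_move_doubled H_move_imp_move_equiv by metis
qed

lemma doubled_insert_pairs:
  assumes "doubled L (x @ y @ z)" "A \<notin> set (x @ y @ z)" "B \<notin> set (x @ y @ z)" "A \<noteq> B"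
  shows "doubled L (x @ [A, B] @ y @ [B, A] @ z)" "doubled L (x @ [A, B] @ y @ [A, B] @ z)"
  using assms by (auto simp: doubled_def count_notin)

lemma H2_insert:
  assumes "doubled L (x @ y @ z)" "A \<notin> set (x @ y @ z)" "B \<notin> set (x @ y @ z)"
    and "A \<in> L" "B \<in> L" "A \<noteq> B"
  shows "move_equiv L (x @ y @ z) (x @ [A, B] @ y @ [B, A] @ z)"
  using assms by (intro move_equiv_sym[OF H2_delete] doubled_insert_pairs)

lemma H3_forward:
  assumes "doubled L (x @ [A, B] @ y @ [A, C] @ z @ [B, C] @ t)"
    and "A \<in> L" "B \<in> L" "C \<in> L" "distinct [A, B, C]"
  shows "move_equiv L (x @ [A, B] @ y @ [A, C] @ z @ [B, C] @ t)
                      (x @ [B, A] @ y @ [C, A] @ z @ [C, B] @ t)"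
proof -
  have "H_move L (x @ [A, B] @ y @ [A, C] @ z @ [B, C] @ t)
                 (x @ [B, A] @ y @ [C, A] @ z @ [C, B] @ t)"
    using assms by (intro H_move.H3) auto
  then show ?thesis
    using assms(1) H_move_doubled H_move_imp_move_equiv by metis
qed

lemma H3_backward:
  assumes "doubled L (x @ [B, A] @ y @ [C, A] @ z @ [C, B] @ t)"
    and "A \<in> L" "B \<in> L" "C \<in> L" "distinct [A, B, C]"
  shows "move_equiv L (x @ [B, A] @ y @ [C, A] @ z @ [C, B] @ t)
                      (x @ [A, B] @ y @ [A, C] @ z @ [B, C] @ t)"
proof -
  have "count_list (x @ [A, B] @ y @ [A, C] @ z @ [B, C] @ t) S =
        count_list (x @ [B, A] @ y @ [C, A] @ z @ [C, B] @ t) S" for S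
    by simp
  then have "doubled L (x @ [A, B] @ y @ [A, C] @ z @ [B, C] @ t)"
    using assms(1) unfolding doubled_def by metis
  then show ?thesis
    using assms by (intro move_equiv_sym[OF H3_forward])
qed

lemma obtain_fresh:
  assumes "infinite L"
  obtains A where "A \<in> L" "A \<notin> set s"
  using assms by (meson List.finite_set finite_subset subsetI)

section \<open>Derived moves\<close>

text \<open>The pieces \<open>x\<close>, \<open>y\<close>, \<open>z\<close>, \<open>t\<close> below are arbitrary lists, so that in an application to phrases
  any one of them may contain the separator.\<close>

text \<open>Two H2 insertions surround \<open>A\<close> and \<open>B\<close> with four fresh letters in such a way that after one H3
  move on \<open>Q\<close>, \<open>A\<close>, \<open>D\<close> all letters can be removed in turn: \<open>Q\<close> and \<open>B\<close> cancel by H2, then \<open>D\<close> by H1, then \<open>P\<close> and \<open>A\<close> by H2, then \<open>C\<close> by H1.\<close>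

lemma H2_parallel_delete:
  assumes "infinite L" and d: "doubled L (x @ [A, B] @ y @ [A, B] @ z)"
    and L: "A \<in> L" "B \<in> L" and AB: "A \<noteq> B"
  shows "move_equiv L (x @ [A, B] @ y @ [A, B] @ z) (x @ y @ z)"
proof -
  obtain C where C: "C \<in> L" "C \<notin> set (x @ [A, B] @ y @ z)"
    using obtain_fresh[OF assms(1)] by blast
  obtain D where D: "D \<in> L" "D \<notin> set (C # x @ [A, B] @ y @ z)"
    using obtain_fresh[OF assms(1)] by blast
  obtain P where P: "P \<in> L" "P \<notin> set (C # D # x @ [A, B] @ y @ z)"
    using obtain_fresh[OF assms(1)] by blast
  obtain Q where Q: "Q \<in> L" "Q \<notin> set (C # D # P # x @ [A, B] @ y @ z)"
    using obtain_fresh[OF assms(1)] by blast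
  note facts = C D P Q L AB
  have 1: "move_equiv L (x @ [A, B] @ y @ [A, B] @ z) (x @ [A, B] @ y @ [C, D, A, B, D, C] @ z)"
    using H2_insert[of L "x @ [A, B] @ y" "[A, B]" z C D] d facts by auto
  have 2: "move_equiv L (x @ [A, B] @ y @ [C, D, A, B, D, C] @ z)
                        (x @ [P, Q, A, B] @ y @ [C, D, A, B, D, Q, P, C] @ z)"
    using H2_insert[of L x "[A, B] @ y @ [C, D, A, B, D]" "[C] @ z" P Q]
      move_equiv_doubled[OF 1] facts by auto
  have 3: "move_equiv L (x @ [P, Q, A, B] @ y @ [C, D, A, B, D, Q, P, C] @ z)
                        (x @ [P, A, Q, B] @ y @ [C, A, D, B, Q, D, P, C] @ z)"
    using H3_backward[of L "x @ [P]" Q A "[B] @ y @ [C]" D "[B]" "[P, C] @ z"]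
      move_equiv_doubled[OF 2] facts by auto
  have 4: "move_equiv L (x @ [P, A, Q, B] @ y @ [C, A, D, B, Q, D, P, C] @ z)
                        (x @ [P, A] @ y @ [C, A, D, D, P, C] @ z)"
    using H2_delete[of L "x @ [P, A]" Q B "y @ [C, A, D]" "[D, P, C] @ z"]
      move_equiv_doubled[OF 3] facts by auto
  have 5: "move_equiv L (x @ [P, A] @ y @ [C, A, D, D, P, C] @ z)
                        (x @ [P, A] @ y @ [C, A, P, C] @ z)"
    using H1_delete[of L "x @ [P, A] @ y @ [C, A]" D "[P, C] @ z"]
      move_equiv_doubled[OF 4] facts by auto
  have 6: "move_equiv L (x @ [P, A] @ y @ [C, A, P, C] @ z) (x @ y @ [C, C] @ z)"
    using H2_delete[of L x P A "y @ [C]" "[C] @ z"]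
      move_equiv_doubled[OF 5] facts by auto
  have 7: "move_equiv L (x @ y @ [C, C] @ z) (x @ y @ z)"
    using H1_delete[of L "x @ y" C z] move_equiv_doubled[OF 6] facts by auto
  show ?thesis
    using 1 2 3 4 5 6 7 by (blast intro: move_equiv_trans)
qed

lemma H2_parallel_insert:
  assumes "infinite L" "doubled L (x @ y @ z)" "A \<notin> set (x @ y @ z)" "B \<notin> set (x @ y @ z)"
    and "A \<in> L" "B \<in> L" "A \<noteq> B"
  shows "move_equiv L (x @ y @ z) (x @ [A, B] @ y @ [A, B] @ z)"
  using assms by (intro move_equiv_sym[OF H2_parallel_delete] doubled_insert_pairs)

text \<open>The three variants of H3 (up to direction) are named after the sites that are reversed in
  comparison with \<open>AB\<close>, \<open>AC\<close>, \<open>BC\<close>. Each is derived by one standard H3 move on a triple that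
  contains a fresh letter; the H2 moves before and after it exchange fresh letters with \<open>A\<close>, \<open>B\<close>
  or \<open>C\<close>. Here \<open>D\<close> takes the place of \<open>B\<close>, and \<open>B\<close> is inserted again around the
  whole configuration; the move is made on \<open>E\<close>, \<open>A\<close>, \<open>C\<close>, and finally \<open>E\<close> and \<open>D\<close> cancel.\<close>

lemma H3_variant_second:
  assumes inf: "infinite L" and d: "doubled L (x @ [A, B] @ y @ [C, A] @ z @ [B, C] @ t)"
    and L: "A \<in> L" "B \<in> L" "C \<in> L" and ABC: "distinct [A, B, C]"
  shows "move_equiv L (x @ [A, B] @ y @ [C, A] @ z @ [B, C] @ t)
                      (x @ [B, A] @ y @ [A, C] @ z @ [C, B] @ t)"
proof -
  obtain D where D: "D \<in> L" "D \<notin> set (x @ [A, B, C] @ y @ z @ t)"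
    using obtain_fresh[OF inf] by blast
  obtain E where E: "E \<in> L" "E \<notin> set (D # x @ [A, B, C] @ y @ z @ t)"
    using obtain_fresh[OF inf] by blast
  have "B \<notin> set (x @ y @ z @ t)"
    using d L ABC by (auto simp: doubled_def count_list_0_iff dest!: bspec[of _ _ B])
  note facts = D E L ABC this
  have 1: "move_equiv L (x @ [A, B] @ y @ [C, A] @ z @ [B, C] @ t)
                        (x @ [A, D, E, B] @ y @ [C, A] @ z @ [B, E, D, C] @ t)"
    using H2_insert[of L "x @ [A]" "[B] @ y @ [C, A] @ z @ [B]" "[C] @ t" D E] d facts by auto
  have 2: "move_equiv L (x @ [A, D, E, B] @ y @ [C, A] @ z @ [B, E, D, C] @ t)
                        (x @ [A, D] @ y @ [C, A] @ z @ [D, C] @ t)"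
    using H2_delete[of L "x @ [A, D]" E B "y @ [C, A] @ z" "[D, C] @ t"]
      move_equiv_doubled[OF 1] facts by auto
  have 3: "move_equiv L (x @ [A, D] @ y @ [C, A] @ z @ [D, C] @ t)
                        (x @ [B, E, A, D] @ y @ [C, A] @ z @ [D, C, E, B] @ t)"
    using H2_insert[of L x "[A, D] @ y @ [C, A] @ z @ [D, C]" t B E]
      move_equiv_doubled[OF 2] facts by auto
  have 4: "move_equiv L (x @ [B, E, A, D] @ y @ [C, A] @ z @ [D, C, E, B] @ t)
                        (x @ [B, A, E, D] @ y @ [A, C] @ z @ [D, E, C, B] @ t)"
    using H3_backward[of L "x @ [B]" E A "[D] @ y" C "z @ [D]" "[B] @ t"]
      move_equiv_doubled[OF 3] facts by auto
  have 5: "move_equiv L (x @ [B, A, E, D] @ y @ [A, C] @ z @ [D, E, C, B] @ t)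
                        (x @ [B, A] @ y @ [A, C] @ z @ [C, B] @ t)"
    using H2_delete[of L "x @ [B, A]" E D "y @ [A, C] @ z" "[C, B] @ t"]
      move_equiv_doubled[OF 4] facts by auto
  show ?thesis
    using 1 2 3 4 5 by (blast intro: move_equiv_trans)
qed

text \<open>A parallel pair \<open>DE\<close> is inserted, the standard move is made on \<open>A\<close>, \<open>B\<close>, \<open>D\<close>, and the pair \<open>CD\<close>
  is deleted, which leaves \<open>E\<close> in the place of \<open>C\<close>; the last two steps rename it back to \<open>C\<close>.\<close>

lemma H3_variant_second_third:
  assumes inf: "infinite L" and d: "doubled L (x @ [A, B] @ y @ [C, A] @ z @ [C, B] @ t)"
    and L: "A \<in> L" "B \<in> L" "C \<in> L" and ABC: "distinct [A, B, C]"
  shows "move_equiv L (x @ [A, B] @ y @ [C, A] @ z @ [C, B] @ t)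
                      (x @ [B, A] @ y @ [A, C] @ z @ [B, C] @ t)"
proof -
  obtain D where D: "D \<in> L" "D \<notin> set (x @ [A, B, C] @ y @ z @ t)"
    using obtain_fresh[OF inf] by blast
  obtain E where E: "E \<in> L" "E \<notin> set (D # x @ [A, B, C] @ y @ z @ t)"
    using obtain_fresh[OF inf] by blast
  have "C \<notin> set (x @ y @ z @ t)"
    using d L ABC by (auto simp: doubled_def count_list_0_iff dest!: bspec[of _ _ C])
  note facts = D E L ABC this
  have 1: "move_equiv L (x @ [A, B] @ y @ [C, A] @ z @ [C, B] @ t)
                        (x @ [A, B] @ y @ [C, A, D, E] @ z @ [C, B, D, E] @ t)"
    using H2_parallel_insert[OF inf, of "x @ [A, B] @ y @ [C, A]" "z @ [C, B]" t D E] d facts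
    by auto
  have 2: "move_equiv L (x @ [A, B] @ y @ [C, A, D, E] @ z @ [C, B, D, E] @ t)
                        (x @ [B, A] @ y @ [C, D, A, E] @ z @ [C, D, B, E] @ t)"
    using H3_forward[of L x A B "y @ [C]" D "[E] @ z @ [C]" "[E] @ t"]
      move_equiv_doubled[OF 1] facts by auto
  have 3: "move_equiv L (x @ [B, A] @ y @ [C, D, A, E] @ z @ [C, D, B, E] @ t)
                        (x @ [B, A] @ y @ [A, E] @ z @ [B, E] @ t)"
    using H2_parallel_delete[OF inf, of "x @ [B, A] @ y" C D "[A, E] @ z" "[B, E] @ t"]
      move_equiv_doubled[OF 2] facts by auto
  have 4: "move_equiv L (x @ [B, A] @ y @ [A, E] @ z @ [B, E] @ t)
                        (x @ [B, A] @ y @ [A, C, D, E] @ z @ [B, E, D, C] @ t)"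
    using H2_insert[of L "x @ [B, A] @ y @ [A]" "[E] @ z @ [B, E]" t C D]
      move_equiv_doubled[OF 3] facts by auto
  have 5: "move_equiv L (x @ [B, A] @ y @ [A, C, D, E] @ z @ [B, E, D, C] @ t)
                        (x @ [B, A] @ y @ [A, C] @ z @ [B, C] @ t)"
    using H2_delete[of L "x @ [B, A] @ y @ [A, C]" D E "z @ [B]" "[C] @ t"]
      move_equiv_doubled[OF 4] facts by auto
  show ?thesis
    using 1 2 3 4 5 by (blast intro: move_equiv_trans)
qed

text \<open>The same method with the standard move on \<open>D\<close>, \<open>B\<close>, \<open>C\<close>: here \<open>E\<close> ends in the place of \<open>A\<close> and
  is renamed back in the last two steps.\<close>

lemma H3_variant_third:
  assumes inf: "infinite L" and d: "doubled L (x @ [A, B] @ y @ [A, C] @ z @ [C, B] @ t)"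
    and L: "A \<in> L" "B \<in> L" "C \<in> L" and ABC: "distinct [A, B, C]"
  shows "move_equiv L (x @ [A, B] @ y @ [A, C] @ z @ [C, B] @ t)
                      (x @ [B, A] @ y @ [C, A] @ z @ [B, C] @ t)"
proof -
  obtain D where D: "D \<in> L" "D \<notin> set (x @ [A, B, C] @ y @ z @ t)"
    using obtain_fresh[OF inf] by blast
  obtain E where E: "E \<in> L" "E \<notin> set (D # x @ [A, B, C] @ y @ z @ t)"
    using obtain_fresh[OF inf] by blast
  have "A \<notin> set (x @ y @ z @ t)"
    using d L ABC by (auto simp: doubled_def count_list_0_iff dest!: bspec[of _ _ A])
  note facts = D E L ABC this
  have 1: "move_equiv L (x @ [A, B] @ y @ [A, C] @ z @ [C, B] @ t)
                        (x @ [A, B, D, E] @ y @ [A, C, D, E] @ z @ [C, B] @ t)"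
    using H2_parallel_insert[OF inf, of "x @ [A, B]" "y @ [A, C]" "z @ [C, B] @ t" D E] d facts
    by auto
  have 2: "move_equiv L (x @ [A, B, D, E] @ y @ [A, C, D, E] @ z @ [C, B] @ t)
                        (x @ [A, D, B, E] @ y @ [A, D, C, E] @ z @ [B, C] @ t)"
    using H3_backward[of L "x @ [A]" B D "[E] @ y @ [A]" C "[E] @ z" t]
      move_equiv_doubled[OF 1] facts by auto
  have 3: "move_equiv L (x @ [A, D, B, E] @ y @ [A, D, C, E] @ z @ [B, C] @ t)
                        (x @ [B, E] @ y @ [C, E] @ z @ [B, C] @ t)"
    using H2_parallel_delete[OF inf, of x A D "[B, E] @ y" "[C, E] @ z @ [B, C] @ t"]
      move_equiv_doubled[OF 2] facts by auto
  have 4: "move_equiv L (x @ [B, E] @ y @ [C, E] @ z @ [B, C] @ t)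
                        (x @ [B, A, D, E] @ y @ [C, A, D, E] @ z @ [B, C] @ t)"
    using H2_parallel_insert[OF inf, of "x @ [B]" "[E] @ y @ [C]" "[E] @ z @ [B, C] @ t" A D]
      move_equiv_doubled[OF 3] facts by auto
  have 5: "move_equiv L (x @ [B, A, D, E] @ y @ [C, A, D, E] @ z @ [B, C] @ t)
                        (x @ [B, A] @ y @ [C, A] @ z @ [B, C] @ t)"
    using H2_parallel_delete[OF inf, of "x @ [B, A]" D E "y @ [C, A]" "z @ [B, C] @ t"]
      move_equiv_doubled[OF 4] facts by auto
  show ?thesis
    using 1 2 3 4 5 by (blast intro: move_equiv_trans)
qed

text \<open>Each site has two orientations and a move reverses all three, so the eight configurations
  form four moves: H3 and its three variants.\<close>

lemma H3_any_orientation: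
  assumes inf: "infinite L" and d: "doubled L (x @ a @ y @ b @ z @ c @ t)"
    and L: "A \<in> L" "B \<in> L" "C \<in> L" and ABC: "distinct [A, B, C]"
    and st: "a \<in> {[A, B], [B, A]}" "b \<in> {[A, C], [C, A]}" "c \<in> {[B, C], [C, B]}"
  shows "move_equiv L (x @ a @ y @ b @ z @ c @ t) (x @ rev a @ y @ rev b @ z @ rev c @ t)"
proof -
  have d': "doubled L (x @ rev a @ y @ rev b @ z @ rev c @ t)"
    using d by (simp add: doubled_def)
  note facts = inf L ABC
  show ?thesis
  proof (cases "a = [A, B]")
    case True
    then show ?thesis
      using st d facts H3_forward[of L x A B y C z t] H3_variant_second[of L x A B y C z t]
        H3_variant_second_third[of L x A B y C z t] H3_variant_third[of L x A B y C z t]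
      by auto
  next
    case False
    then have a: "a = [B, A]"
      using st by auto
    show ?thesis
      using st d' facts
        H3_forward[of L x A B y C z t, THEN move_equiv_sym]
        H3_variant_second[of L x A B y C z t, THEN move_equiv_sym]
        H3_variant_second_third[of L x A B y C z t, THEN move_equiv_sym]
        H3_variant_third[of L x A B y C z t, THEN move_equiv_sym]
      unfolding a by auto
  qed
qed

section \<open>Moves on words cut into blocks\<close>

text \<open>A word on which a move is to be made is written as \<open>concat U\<close>, where the displayed two-letter
  subwords (the sites) are blocks of \<open>U\<close> and all other blocks are single symbols. The move then
  acts on every block by one function, \<open>rev\<close> for H3 and \<open>drop_site\<close> for H1 and H2, which does
  nothing to a single symbol. Hence permuting the blocks commutes with the move, and cutting out a
  part of the word is such a permutation. The lemmas below prescribe only the multiset of sites,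
  not their order.\<close>

definition sites :: "'s list list \<Rightarrow> 's list list" where
  "sites U = filter (\<lambda>b. length b \<noteq> 1) U"

definition drop_site :: "'s list \<Rightarrow> 's list" where
  "drop_site b = (if length b = 1 then b else [])"

lemma concat_map_rev_no_sites: "sites U = [] \<Longrightarrow> concat (map rev U) = concat U"
  by (induction U) (auto simp: sites_def length_Suc_conv split: if_splits)

lemma concat_map_drop_site_no_sites: "sites U = [] \<Longrightarrow> concat (map drop_site U) = concat U"
  by (induction U) (auto simp: sites_def drop_site_def split: if_splits)

lemma sites_eq_ConsE:
  assumes "sites U = a # r"
  obtains x V where "U = x @ [a] @ V" "sites x = []" "sites V = r"
proof -
  obtain x V where "U = x @ a # V" "\<forall>u\<in>set x. \<not> length u \<noteq> 1"
    "r = filter (\<lambda>b. length b \<noteq> 1) V"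
    using assms unfolding sites_def filter_eq_Cons_iff by blast
  then show thesis
    by (intro that[of x V]) (auto simp: sites_def)
qed

lemma H1_blocks:
  assumes d: "doubled L (concat U)" and L: "A \<in> L"
    and st: "mset (sites U) = {#[A, A]#}"
  shows "move_equiv L (concat U) (concat (map drop_site U))"
proof -
  have "sites U = [[A, A]]"
    using st by simp
  then obtain x y where U: "U = x @ [[A, A]] @ y" and s: "sites x = []" "sites y = []"
    by (rule sites_eq_ConsE)
  show ?thesis
    using H1_delete[of L "concat x" A "concat y"] d L
    by (simp add: U s concat_map_drop_site_no_sites drop_site_def[of "[A, A]"])
qed

lemma H2_blocks:
  assumes d: "doubled L (concat U)" and L: "A \<in> L" "B \<in> L" and AB: "A \<noteq> B"
    and st: "mset (sites U) = {#[A, B], [B, A]#}"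
  shows "move_equiv L (concat U) (concat (map drop_site U))"
proof -
  have "length (sites U) = 2"
    using arg_cong[OF st, of size] by simp
  then obtain a b where ab: "sites U = [a, b]"
    by (auto simp: length_Suc_conv numeral_2_eq_2)
  with st have order: "a = [A, B] \<and> b = [B, A] \<or> a = [B, A] \<and> b = [A, B]"
    by (auto simp: add_eq_conv_ex)
  from ab obtain x V where V: "U = x @ [a] @ V" "sites x = []" "sites V = [b]"
    by (rule sites_eq_ConsE)
  from V(3) obtain y z where "V = y @ [b] @ z" "sites y = []" "sites z = []"
    by (rule sites_eq_ConsE)
  with V have U: "U = x @ [a] @ y @ [b] @ z"
    and s: "sites x = []" "sites y = []" "sites z = []"
    by auto
  have ds: "drop_site a = []" "drop_site b = []"
    using order by (auto simp: drop_site_def)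
  show ?thesis
    using order H2_delete[of L "concat x" A B "concat y" "concat z"]
      H2_delete[of L "concat x" B A "concat y" "concat z"] d L AB
    by (auto simp: U s ds concat_map_drop_site_no_sites)
qed

text \<open>Reading the sites in another order amounts to permuting the roles of \<open>A\<close>, \<open>B\<close>, \<open>C\<close>, at the
  price of reversing some of the sites.\<close>

lemma H3_blocks:
  assumes inf: "infinite L" and d: "doubled L (concat U)"
    and L: "A \<in> L" "B \<in> L" "C \<in> L" and ABC: "distinct [A, B, C]"
    and st: "mset (sites U) = {#[A, B], [A, C], [B, C]#}"
  shows "move_equiv L (concat U) (concat (map rev U))"
proof -
  have "length (sites U) = 3"
    using arg_cong[OF st, of size] by simp
  then obtain a b c where abc: "sites U = [a, b, c]"
    by (auto simp: length_Suc_conv numeral_3_eq_3)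
  with st consider
    "a = [A, B]" "b = [A, C]" "c = [B, C]"
  | "a = [A, B]" "b = [B, C]" "c = [A, C]"
  | "a = [A, C]" "b = [A, B]" "c = [B, C]"
  | "a = [A, C]" "b = [B, C]" "c = [A, B]"
  | "a = [B, C]" "b = [A, B]" "c = [A, C]"
  | "a = [B, C]" "b = [A, C]" "c = [A, B]"
    by (auto simp: add_eq_conv_ex)
  note order = this
  from abc obtain x V where V: "U = x @ [a] @ V" "sites x = []" "sites V = [b, c]"
    by (rule sites_eq_ConsE)
  from V(3) obtain y W where W: "V = y @ [b] @ W" "sites y = []" "sites W = [c]"
    by (rule sites_eq_ConsE)
  from W(3) obtain z t where "W = z @ [c] @ t" "sites z = []" "sites t = []"
    by (rule sites_eq_ConsE)
  with V W have U: "U = x @ [a] @ y @ [b] @ z @ [c] @ t"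
    and s: "sites x = []" "sites y = []" "sites z = []" "sites t = []"
    by auto
  have d': "doubled L (concat x @ a @ concat y @ b @ concat z @ c @ concat t)"
    using d by (simp add: U)
  note any = H3_any_orientation[OF inf d']
  have "move_equiv L (concat x @ a @ concat y @ b @ concat z @ c @ concat t)
                     (concat x @ rev a @ concat y @ rev b @ concat z @ rev c @ concat t)"
  proof (cases rule: order)
    case 1
    then show ?thesis
      using any[of A B C] L ABC by auto
  next
    case 2
    then show ?thesis
      using any[of B A C] L ABC by auto
  next
    case 3
    then show ?thesis
      using any[of A C B] L ABC by auto
  next
    case 4
    then show ?thesis
      using any[of C A B] L ABC by auto
  next
    case 5
    then show ?thesis
      using any[of B C A] L ABC by auto
  next
    case 6
    then show ?thesis
      using any[of C B A] L ABC by auto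
  qed
  then show ?thesis
    by (simp add: U s concat_map_rev_no_sites)
qed

section \<open>From symbol sequences to mixed homotopy\<close>

lemma gauss_word_iff_doubled: "gauss_word w \<longleftrightarrow> doubled UNIV w"
  by (auto simp: gauss_word_def doubled_def count_list_0_iff)

lemma gauss_phrase_iff_doubled: "gauss_phrase P \<longleftrightarrow> doubled (range Letter) (symbols P)"
proof -
  have "count_list (symbols P) (Letter A) = count_list (fst P @ snd P) A" for A
    by (simp add: symbols_def count_list_map_conv inj_def)
  then show ?thesis
    unfolding gauss_phrase_def gauss_word_iff_doubled by (simp add: doubled_def)
qed

lemma inj_symbols: "symbols P = symbols Q \<Longrightarrow> P = Q"
proof -
  have "map Letter u @ Separator # v = map Letter u' @ Separator # v' \<Longrightarrow> u = u' \<and> v = v'"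
    for u u' :: "'a list" and v v'
  proof (induction u arbitrary: u')
    case Nil
    then show ?case by (cases u') auto
  next
    case (Cons a u)
    then show ?case by (cases u') auto
  qed
  moreover assume "symbols P = symbols Q"
  ultimately have "fst P = fst Q \<and> map Letter (snd P) = map Letter (snd Q)"
    unfolding symbols_def by auto
  then show "P = Q"
    by (auto simp: prod_eq_iff inj_map_eq_map inj_def)
qed

lemma ex_symbols_eq:
  assumes "count_list s Separator = 1"
  obtains P where "s = symbols P"
proof -
  obtain u v where s: "s = u @ Separator # v" "Separator \<notin> set u" "count_list v Separator = 0"
    using assms count_list_Suc_split_first[of s Separator 0] by auto
  then have "Separator \<notin> set v"
    by (simp add: count_list_0_iff)
  with s have "\<exists>u'. u = map Letter u'" "\<exists>v'. v = map Letter v'"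
    unfolding ex_map_conv by (metis symbol.exhaust)+
  then obtain u' v' where "u = map Letter u'" "v = map Letter v'"
    by blast
  with s that[of "(u', v')"] show thesis
    by (simp add: symbols_def)
qed

lemma H_move_count_separator:
  "H_move (range Letter) u v \<Longrightarrow> count_list u Separator = count_list v Separator"
  by (induction rule: H_move.induct) auto

text \<open>The moves preserve the number of separators, so every sequence between \<open>symbols P\<close> and
  \<open>symbols Q\<close> in a chain of moves is again the sequence of a phrase.\<close>

lemma move_equiv_imp_mixed_homotopy:
  assumes "move_equiv (range Letter) (symbols P) (symbols Q)"
  shows "(P, Q) \<in> mixed_homotopy"
proof -
  let ?r = "\<lambda>u v :: 'a symbol list. doubled (range Letter) u \<and> doubled (range Letter) v \<and>
    H_move (range Letter) u v"
  have "\<exists>R. s = symbols R \<and> equivclp mixed_step P R" if "equivclp ?r (symbols P) s" for s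
    using that
  proof (induction rule: equivclp_induct)
    case base
    show ?case by (intro exI[of _ P]) simp
  next
    case (step s s')
    then obtain R where R: "s = symbols R" "equivclp mixed_step P R"
      by blast
    have "count_list (symbols R) Separator = 1"
      by (auto simp: symbols_def count_list_0_iff)
    with step(2) R have "count_list s' Separator = 1"
      using H_move_count_separator by metis
    then obtain R' where R': "s' = symbols R'"
      by (rule ex_symbols_eq)
    then have "mixed_step R R' \<or> mixed_step R' R"
      using step(2) R(1) by (auto simp: mixed_step_def gauss_phrase_iff_doubled)
    then show ?case
      using R R' by (blast intro: equivclp_trans)
  qed
  from this[of "symbols Q"] assms show ?thesis
    by (auto simp: move_equiv_def mixed_homotopy_def gauss_phrase_iff_doubled dest!: inj_symbols)
qed

lemma mixed_class_eqI: "(P, Q) \<in> mixed_homotopy \<Longrightarrow> mixed_class P = mixed_class Q"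
  unfolding mixed_class_def by (rule equiv_class_eq[OF equiv_mixed_homotopy])

lemma mixed_class_move:
  "move_equiv (range Letter) (symbols P) (symbols Q) \<Longrightarrow> mixed_class P = mixed_class Q"
  by (intro mixed_class_eqI move_equiv_imp_mixed_homotopy)

lemma mixed_class_step:
  "mixed_step P Q \<Longrightarrow> mixed_class P = mixed_class Q"
  by (intro mixed_class_eqI) (auto simp: mixed_homotopy_def mixed_step_def)

lemma gauss_phrase_shift: "gauss_phrase (A # u, v) \<Longrightarrow> gauss_phrase (u @ [A], v)"
proof -
  have "count_list ((u @ [A]) @ v) S = count_list ((A # u) @ v) S" for S
    by simp
  then show "gauss_phrase (A # u, v) \<Longrightarrow> gauss_phrase (u @ [A], v)"
    unfolding gauss_phrase_def gauss_word_iff_doubled doubled_def by simp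
qed

lemma mixed_class_shift:
  "gauss_phrase (A # u, v) \<Longrightarrow> mixed_class (A # u, v) = mixed_class (u @ [A], v)"
  by (intro mixed_class_step) (simp add: mixed_step_def shift_first.intros gauss_phrase_shift)

lemma mixed_class_rename:
  assumes "gauss_phrase (u, v)" "inj_on f (set u \<union> set v)"
  shows "mixed_class (u, v) = mixed_class (map f u, map f v)"
proof (rule mixed_class_step)
  have "gauss_word (map f (u @ v))"
    using assms unfolding gauss_phrase_def gauss_word_def
    by (auto simp: count_list_inj_map simp del: map_append simp flip: set_append)
  then have "gauss_phrase (map f u, map f v)"
    by (simp add: gauss_phrase_def)
  moreover have "phrase_iso (u, v) (map f u, map f v)"
    unfolding phrase_iso_def using assms(2)
    by (auto simp: bij_betw_def intro!: exI[of _ f])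
  ultimately show "mixed_step (u, v) (map f u, map f v)"
    using assms(1) by (simp add: mixed_step_def)
qed


section \<open>Letters that are not involved in a move\<close>

lemma gauss_word_count: "gauss_word w \<Longrightarrow> A \<in> set w \<Longrightarrow> count_list w A = 2"
  by (simp add: gauss_word_def)

lemma split_at_block:
  assumes g: "gauss_word (concat T)" and D: "D \<in> set (concat T)" "D \<notin> set (concat (sites T))"
  obtains X Y Z where "T = X @ [[D]] @ Y @ [[D]] @ Z"
proof -
  have "\<forall>b\<in>set T. length b \<noteq> 1 \<longrightarrow> D \<notin> set b"
    using D(2) by (auto simp: sites_def)
  then have "count_list (concat T) D = count_list T [D]"
    by (induction T) (auto simp: sites_def length_Suc_conv split: if_splits)
  moreover have "count_list (concat T) D = 2"
    using g D(1) by (rule gauss_word_count)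
  ultimately have "count_list T [D] = Suc 1"
    by simp
  then obtain X R where R: "T = X @ [D] # R" "count_list R [D] = Suc 0"
    by (auto dest: count_list_Suc_split_first)
  from R(2) obtain Y Z where "R = Y @ [D] # Z"
    by (auto dest: count_list_Suc_split_first)
  with R that show thesis
    by simp
qed

text \<open>The function \<open>f\<close> is the action of a move on the blocks of a word and \<open>f'\<close> its counterpart on
  sequences with a separator. A letter \<open>D\<close> outside the sites occurs as two blocks \<open>[D]\<close>. The phrase
  cut out at \<open>D\<close> consists of the remaining blocks, rearranged, and a separator block, so it carries
  the same sites, and \<open>f'\<close> maps it to the phrase that is cut out after the move.\<close>

lemma uninvolved_letters:
  fixes T :: "'a list list"
  assumes nat: "\<And>b. map Letter (f b) = f' (map Letter b)"
    and fixed: "\<And>c. f [c] = [c]" "\<And>c. f' [c] = [c]"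
    and move: "\<forall>U. mset (sites U) = mset (map (map Letter) (sites T)) \<longrightarrow>
      doubled (range Letter) (concat U) \<longrightarrow>
      move_equiv (range Letter) (concat U) (concat (map f' U))"
    and g: "gauss_word (concat T)" and g': "gauss_word (concat (map f T))"
  shows t_m_blocks: "t_m (concat T) = t_m (concat (map f T))"
    and u_m_blocks: "D \<in> set (concat T) \<Longrightarrow> D \<notin> set (concat (sites T)) \<Longrightarrow>
      u_m (concat T) D = u_m (concat (map f T)) D"
proof -
  let ?phrase = "\<lambda>Y Z. map (map Letter) Y @ [[Separator]] @ map (map Letter) Z"
  have phrase_eq: "mixed_class (concat Y, concat Z) = mixed_class (concat (map f Y), concat (map f Z))"
    if YZ: "gauss_phrase (concat Y, concat Z)" "mset (sites (Y @ Z)) = mset (sites T)" for Y Z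
  proof (rule mixed_class_move)
    have sy: "symbols (concat Y, concat Z) = concat (?phrase Y Z)" for Y Z :: "'a list list"
      by (simp add: symbols_def map_concat)
    have "map f' (?phrase Y Z) = ?phrase (map f Y) (map f Z)"
      by (simp add: nat fixed)
    then have sy': "symbols (concat (map f Y), concat (map f Z)) = concat (map f' (?phrase Y Z))"
      by (simp only: sy)
    have "sites (?phrase Y Z) = map (map Letter) (sites (Y @ Z))"
      by (simp add: sites_def filter_map comp_def)
    then have "mset (sites (?phrase Y Z)) = mset (map (map Letter) (sites T))"
      using YZ(2) by simp
    moreover have "doubled (range Letter) (concat (?phrase Y Z))"
      using YZ(1) by (simp only: gauss_phrase_iff_doubled sy)
    ultimately show "move_equiv (range Letter) (symbols (concat Y, concat Z))
        (symbols (concat (map f Y), concat (map f Z)))"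
      unfolding sy[of Y Z] sy' using move by blast
  qed
  from g show "t_m (concat T) = t_m (concat (map f T))"
    using phrase_eq[of "[]" T] by (simp add: t_m_def gauss_phrase_def)
  assume D: "D \<in> set (concat T)" "D \<notin> set (concat (sites T))"
  then obtain X Y Z where T: "T = X @ [[D]] @ Y @ [[D]] @ Z"
    using split_at_block[OF g] by blast
  have p: "p (concat T) D = (concat Y, concat (X @ Z))"
    using p_eq[of "concat X" D "concat Y" "concat Z"] g by (simp add: T)
  have p': "p (concat (map f T)) D = (concat (map f Y), concat (map f (X @ Z)))"
    using p_eq[of "concat (map f X)" D "concat (map f Y)" "concat (map f Z)"] g'
    by (simp add: T fixed)
  have "mset (sites (Y @ X @ Z)) = mset (sites T)"
    by (simp add: T sites_def)
  then show "u_m (concat T) D = u_m (concat (map f T)) D"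
    using phrase_eq[of Y "X @ Z"] gauss_phrase_p[OF g D(1)] by (simp add: u_m_def p p')
qed

section \<open>Invariance under the individual moves\<close>

abbreviation letters :: "'a list \<Rightarrow> 'a list list" where
  "letters \<equiv> map (\<lambda>c. [c])"

lemma sites_letters [simp]: "sites (letters x) = []"
  by (simp add: sites_def)

lemma sites_append [simp]: "sites (U @ V) = sites U @ sites V"
  by (simp add: sites_def)

lemma drop_site_map: "map f (drop_site b) = drop_site (map f b)"
  by (simp add: drop_site_def)

lemma infinite_range_Letter: "infinite (range (Letter :: 'a::infinite \<Rightarrow> 'a symbol))"
  by (simp add: finite_image_iff inj_def infinite_UNIV)

text \<open>The letter \<open>A\<close> cuts out the empty word, so its summand vanishes; all other summands agree.\<close>

lemma h_H1:
  fixes x y :: "'a list"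
  assumes g: "gauss_word (x @ [A, A] @ y)" and g': "gauss_word (x @ y)"
  shows "h (x @ [A, A] @ y) = h (x @ y)"
proof -
  define T where "T = letters x @ [[A, A]] @ letters y"
  have st: "sites T = [[A, A]]"
    by (simp add: T_def) (simp add: sites_def)
  have T: "concat T = x @ [A, A] @ y" "concat (map drop_site T) = x @ y"
    by (simp_all add: T_def comp_def drop_site_def)
  have notin: "A \<notin> set (x @ y)"
    using gauss_word_count[OF g, of A] by (auto simp: count_list_0_iff)
  have move: "\<forall>U. mset (sites U) = mset (map (map Letter) (sites T)) \<longrightarrow>
      doubled (range Letter) (concat U) \<longrightarrow>
      move_equiv (range Letter) (concat U) (concat (map drop_site U))"
    by (intro allI impI H1_blocks[of _ _ "Letter A"]) (auto simp: st)
  note uninvolved = uninvolved_letters[of drop_site drop_site T, OF drop_site_map _ _ move,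
      unfolded T, OF _ _ g g']
  have t: "t_m (x @ [A, A] @ y) = t_m (x @ y)"
    by (rule uninvolved) (auto simp: drop_site_def)
  have u: "u_m (x @ [A, A] @ y) D = u_m (x @ y) D" if "D \<in> set (x @ y)" for D
    by (rule uninvolved) (use that notin in \<open>auto simp: drop_site_def st\<close>)
  have "u_m (x @ [A, A] @ y) A = t_m (x @ y)"
    using p_eq[of x A "[]" y] g by (simp add: u_m_def t_m_def)
  moreover have "set (x @ [A, A] @ y) = insert A (set (x @ y))"
    by auto
  ultimately show ?thesis
    unfolding h_def t using notin u by simp
qed

text \<open>The phrase of \<open>A\<close> is \<open>ByB|xz\<close>. A shift makes the two letters \<open>B\<close> adjacent, and H1 removes them.
  The phrase of \<open>B\<close> is \<open>y|xAAz\<close>, where H1 applies at once.\<close>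

lemma u_m_H2:
  assumes g: "gauss_word (x @ [A, B] @ y @ [B, A] @ z)"
  shows "u_m (x @ [A, B] @ y @ [B, A] @ z) A = mixed_class (y, x @ z)"
    and "u_m (x @ [A, B] @ y @ [B, A] @ z) B = mixed_class (y, x @ z)"
proof -
  let ?w = "x @ [A, B] @ y @ [B, A] @ z"
  have pA: "p ?w A = (B # y @ [B], x @ z)" and pB: "p ?w B = (y, x @ A # A # z)"
    using p_eq[of x A "B # y @ [B]" z] p_eq[of "x @ [A]" B y "A # z"] g by auto
  have gA: "gauss_phrase (B # y @ [B], x @ z)"
    using gauss_phrase_p[OF g, of A] unfolding pA by simp
  have gB: "gauss_phrase (y, x @ A # A # z)"
    using gauss_phrase_p[OF g, of B] unfolding pB by simp
  have "gauss_phrase ((y @ [B]) @ [B], x @ z)"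
    using gauss_phrase_shift[OF gA] by simp
  then have "mixed_class ((y @ [B]) @ [B], x @ z) = mixed_class (y, x @ z)"
    using H1_delete[of "range Letter" "map Letter y" "Letter B" "Separator # map Letter (x @ z)"]
    by (intro mixed_class_move) (simp add: gauss_phrase_iff_doubled symbols_def)
  then show "u_m ?w A = mixed_class (y, x @ z)"
    unfolding u_m_def pA using mixed_class_shift[OF gA] by simp
  show "u_m ?w B = mixed_class (y, x @ z)"
    unfolding u_m_def pB
    using H1_delete[of "range Letter" "map Letter y @ Separator # map Letter x" "Letter A"
        "map Letter z"] gB
    by (intro mixed_class_move) (simp add: gauss_phrase_iff_doubled symbols_def)
qed

lemma h_H2:
  fixes x y z :: "'a list"
  assumes g: "gauss_word (x @ [A, B] @ y @ [B, A] @ z)" and g': "gauss_word (x @ y @ z)"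
    and AB: "A \<noteq> B"
  shows "h (x @ [A, B] @ y @ [B, A] @ z) =
    frag_cmul 2 (frag_of (mixed_class (y, x @ z)) - frag_of (t_m (x @ y @ z))) + h (x @ y @ z)"
proof -
  let ?w = "x @ [A, B] @ y @ [B, A] @ z" and ?w' = "x @ y @ z"
  define T where "T = letters x @ [[A, B]] @ letters y @ [[B, A]] @ letters z"
  have st: "sites T = [[A, B], [B, A]]"
    by (simp add: T_def) (simp add: sites_def)
  have T: "concat T = ?w" "concat (map drop_site T) = ?w'"
    by (simp_all add: T_def comp_def drop_site_def)
  have notin: "A \<notin> set ?w'" "B \<notin> set ?w'"
    using gauss_word_count[OF g, of A] gauss_word_count[OF g, of B] AB
    by (auto simp: count_list_0_iff)
  have move: "\<forall>U. mset (sites U) = mset (map (map Letter) (sites T)) \<longrightarrow>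
      doubled (range Letter) (concat U) \<longrightarrow>
      move_equiv (range Letter) (concat U) (concat (map drop_site U))"
    using AB by (intro allI impI H2_blocks[of _ _ "Letter A" "Letter B"]) (auto simp: st)
  note uninvolved = uninvolved_letters[of drop_site drop_site T, OF drop_site_map _ _ move,
      unfolded T, OF _ _ g g']
  have t: "t_m ?w = t_m ?w'"
    by (rule uninvolved) (auto simp: drop_site_def)
  have u: "u_m ?w D = u_m ?w' D" if "D \<in> set ?w'" for D
    by (rule uninvolved) (use that notin in \<open>auto simp: drop_site_def st\<close>)
  have s: "set ?w = insert A (insert B (set ?w'))"
    by auto
  have two: "frag_cmul 2 a = a + a" for a :: "'a phrase set \<Rightarrow>\<^sub>0 int"
    using frag_cmul_distrib[of 1 1 a] by simp
  let ?d = "\<lambda>D. frag_of (u_m ?w D) - frag_of (t_m ?w')"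
    and ?e = "frag_of (mixed_class (y, x @ z)) - frag_of (t_m ?w')"
  have "sum ?d (set ?w') = h ?w'"
    unfolding h_def by (rule sum.cong) (simp_all only: u)
  moreover have "?d A = ?e" "?d B = ?e"
    by (simp_all only: u_m_H2[OF g])
  moreover have "h ?w = sum ?d (insert A (insert B (set ?w')))"
    unfolding h_def t s ..
  moreover have "\<dots> = ?d A + (?d B + sum ?d (set ?w'))"
    using notin AB by (simp only: sum.insert finite_insert finite_set insert_iff simp_thms)
  ultimately show ?thesis
    by (simp only: two add.assoc)
qed

lemma mixed_class_swap:
  assumes "gauss_phrase (u, v)"
  shows "mixed_class (u, v) = mixed_class (map (transpose A B) u, map (transpose A B) v)"
  using assms by (rule mixed_class_rename) (rule inj_on_transpose)

lemma map_transpose_idle: "A \<notin> set x \<Longrightarrow> B \<notin> set x \<Longrightarrow> map (transpose A B) x = x"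
  by (induction x) (auto simp: transpose_def)

text \<open>The phrases of \<open>A\<close> are \<open>By|xCzBCt\<close> and \<open>yC|xBzCBt\<close>: a shift of the first gives \<open>yB|xCzBCt\<close>, which
  becomes the second one when \<open>B\<close> and \<open>C\<close> are exchanged. The phrases \<open>zB|xAByAt\<close> and \<open>Az|xBAyBt\<close> of
  \<open>C\<close> are related in the same way. Those of \<open>B\<close>, \<open>yACz|xACt\<close> and \<open>AyCAzC|xt\<close>, have in general
  different linking between the components and are compared through \<open>yz|xt\<close>.\<close>

lemma u_m_H3_involved:
  fixes x y z t :: "'a::infinite list"
  assumes g: "gauss_word (x @ [A, B] @ y @ [A, C] @ z @ [B, C] @ t)"
    and g': "gauss_word (x @ [B, A] @ y @ [C, A] @ z @ [C, B] @ t)"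
    and ABC: "distinct [A, B, C]" and D: "D \<in> {A, B, C}"
  shows "u_m (x @ [A, B] @ y @ [A, C] @ z @ [B, C] @ t) D =
    u_m (x @ [B, A] @ y @ [C, A] @ z @ [C, B] @ t) D"
proof -
  let ?w = "x @ [A, B] @ y @ [A, C] @ z @ [B, C] @ t"
    and ?w' = "x @ [B, A] @ y @ [C, A] @ z @ [C, B] @ t"
  have notin: "A \<notin> set (x @ y @ z @ t)" "B \<notin> set (x @ y @ z @ t)" "C \<notin> set (x @ y @ z @ t)"
    using gauss_word_count[OF g, of A] gauss_word_count[OF g, of B] gauss_word_count[OF g, of C]
      ABC
    by (auto simp: count_list_0_iff)
  have pA: "p ?w A = (B # y, x @ C # z @ B # C # t)"
    and pA': "p ?w' A = (y @ [C], x @ B # z @ C # B # t)"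
    using p_eq[of x A "B # y" "C # z @ [B, C] @ t"] p_eq[of "x @ [B]" A "y @ [C]" "z @ [C, B] @ t"] g g'
    by auto
  have pB: "p ?w B = (y @ [A, C] @ z, x @ [A, C] @ t)"
    and pB': "p ?w' B = (A # y @ [C, A] @ z @ [C], x @ t)"
    using p_eq[of "x @ [A]" B "y @ [A, C] @ z" "C # t"] p_eq[of x B "A # y @ [C, A] @ z @ [C]" t] g g'
    by auto
  have pC: "p ?w C = (z @ [B], x @ [A, B] @ y @ A # t)"
    and pC': "p ?w' C = (A # z, x @ [B, A] @ y @ B # t)"
    using p_eq[of "x @ [A, B] @ y @ [A]" C "z @ [B]" t] p_eq[of "x @ [B, A] @ y" C "A # z" "B # t"] g g'
    by auto
  have gp: "gauss_phrase (p ?w D)" "gauss_phrase (p ?w' D)" if "D \<in> {A, B, C}" for D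
    using gauss_phrase_p[OF g, of D] gauss_phrase_p[OF g', of D] that by auto
  have "u_m ?w A = u_m ?w' A"
  proof -
    have "mixed_class (y @ [C], x @ B # z @ C # B # t) = mixed_class (y @ [B], x @ C # z @ B # C # t)"
      using mixed_class_swap[of "y @ [C]" "x @ B # z @ C # B # t" B C] gp(2)[of A, unfolded pA'] notin
      by (simp add: pA' map_transpose_idle)
    then show ?thesis
      using mixed_class_shift[of B y] gp(1)[of A, unfolded pA]
      unfolding u_m_def pA pA' by simp
  qed
  moreover have "u_m ?w B = u_m ?w' B"
  proof -
    have "mixed_class (y @ [A, C] @ z, x @ [A, C] @ t) = mixed_class (y @ z, x @ t)"
      using H2_parallel_delete[OF infinite_range_Letter, of "map Letter y" "Letter A" "Letter C"
          "map Letter z @ Separator # map Letter x" "map Letter t"] gp(1)[of B, unfolded pB] ABC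
      by (intro mixed_class_move) (simp add: pB gauss_phrase_iff_doubled symbols_def)
    moreover have "gauss_phrase (y @ [C, A] @ z @ [C, A], x @ t)"
      using gp(2)[of B, unfolded pB'] gauss_phrase_shift[of A "y @ [C, A] @ z @ [C]"] by simp
    then have "mixed_class (y @ [C, A] @ z @ [C, A], x @ t) = mixed_class (y @ z, x @ t)"
      using H2_parallel_delete[OF infinite_range_Letter, of "map Letter y" "Letter C" "Letter A"
          "map Letter z" "Separator # map Letter (x @ t)"] ABC
      by (intro mixed_class_move) (auto simp: gauss_phrase_iff_doubled symbols_def)
    ultimately show ?thesis
      using mixed_class_shift[of A "y @ [C, A] @ z @ [C]"] gp(2)[of B, unfolded pB']
      unfolding u_m_def pB pB' by simp
  qed
  moreover have "u_m ?w C = u_m ?w' C"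
  proof -
    have "mixed_class (z @ [B], x @ [A, B] @ y @ A # t) = mixed_class (z @ [A], x @ [B, A] @ y @ B # t)"
      using mixed_class_swap[of "z @ [B]" "x @ [A, B] @ y @ A # t" A B] gp(1)[of C, unfolded pC] notin
      by (simp add: pC map_transpose_idle)
    then show ?thesis
      using mixed_class_shift[of A z] gp(2)[of C, unfolded pC']
      unfolding u_m_def pC pC' by simp
  qed
  ultimately show ?thesis
    using D by auto
qed

lemma h_H3:
  fixes x y z t :: "'a::infinite list"
  assumes g: "gauss_word (x @ [A, B] @ y @ [A, C] @ z @ [B, C] @ t)"
    and g': "gauss_word (x @ [B, A] @ y @ [C, A] @ z @ [C, B] @ t)"
    and ABC: "distinct [A, B, C]"
  shows "h (x @ [A, B] @ y @ [A, C] @ z @ [B, C] @ t) =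
    h (x @ [B, A] @ y @ [C, A] @ z @ [C, B] @ t)"
proof -
  let ?w = "x @ [A, B] @ y @ [A, C] @ z @ [B, C] @ t"
    and ?w' = "x @ [B, A] @ y @ [C, A] @ z @ [C, B] @ t"
  define T where "T = letters x @ [[A, B]] @ letters y @ [[A, C]] @ letters z @ [[B, C]] @ letters t"
  have st: "sites T = [[A, B], [A, C], [B, C]]"
    by (simp add: T_def) (simp add: sites_def)
  have T: "concat T = ?w" "concat (map rev T) = ?w'"
    by (simp_all add: T_def comp_def)
  have move: "\<forall>U. mset (sites U) = mset (map (map Letter) (sites T)) \<longrightarrow>
      doubled (range Letter) (concat U) \<longrightarrow>
      move_equiv (range Letter) (concat U) (concat (map rev U))"
    using ABC
    by (intro allI impI H3_blocks[OF infinite_range_Letter, of _ "Letter A" "Letter B" "Letter C"])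
      (auto simp: st)
  note uninvolved = uninvolved_letters[of rev rev T, OF rev_map[symmetric] _ _ move,
      unfolded T, OF _ _ g g']
  have t: "t_m ?w = t_m ?w'"
    by (rule uninvolved) auto
  have "u_m ?w D = u_m ?w' D" if "D \<in> set ?w" for D
  proof (cases "D \<in> {A, B, C}")
    case True
    then show ?thesis
      by (rule u_m_H3_involved[OF g g' ABC])
  next
    case False
    show ?thesis
      by (rule uninvolved) (use that False in \<open>auto simp: st\<close>)
  qed
  moreover have "set ?w = set ?w'"
    by auto
  ultimately show ?thesis
    unfolding h_def t by (metis (no_types, lifting) sum.cong)
qed

lemma h_word_iso:
  assumes g: "gauss_word u" and iso: "word_iso u v"
  shows "h u = h v"
proof -
  obtain f where f: "bij_betw f (set u) (set v)" and v: "v = map f u"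
    using iso by (auto simp: word_iso_def)
  have inj: "inj_on f (set u)"
    using f by (rule bij_betw_imp_inj_on)
  have t: "t_m u = t_m v"
    using mixed_class_rename[of "[]" u f] g inj by (simp add: t_m_def v gauss_phrase_def)
  have "gauss_word v"
    using g inj by (auto simp: v gauss_word_def count_list_inj_map)
  have u: "u_m u D = u_m v (f D)" if D: "D \<in> set u" for D
  proof -
    obtain x y z where u: "u = x @ [D] @ y @ [D] @ z"
      using gauss_word_split[OF g D] by blast
    have p: "p u D = (y, x @ z)"
      unfolding u by (rule p_eq) (use g u in simp)
    have p': "p v (f D) = (map f y, map f (x @ z))"
      using p_eq[of "map f x" "f D" "map f y" "map f z"] \<open>gauss_word v\<close> by (simp add: v u)
    have "inj_on f (set y \<union> set (x @ z))"
      by (rule inj_on_subset[OF inj]) (auto simp: u)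
    then show ?thesis
      using mixed_class_rename[of y "x @ z" f] gauss_phrase_p[OF g D] by (simp add: u_m_def p p')
  qed
  have "h v = (\<Sum>D\<in>set u. frag_of (u_m v (f D)) - frag_of (t_m v))"
    unfolding h_def by (rule sum.reindex_bij_betw[OF f, symmetric])
  then show ?thesis
    unfolding h_def[of u] by (simp add: t u)
qed

text \<open>The two equal summands that H2 creates disappear in \<open>H/2H\<close>.\<close>

lemma phi_add_double:
  assumes "c \<in> carrier H_group" "d \<in> carrier H_group"
  shows "phi (frag_cmul 2 c + d) = phi d"
proof -
  interpret comm_group "H_group :: ('a phrase set \<Rightarrow>\<^sub>0 int) monoid"
    by (rule comm_group_H_group)
  have "frag_cmul 2 c \<in> two_H"
    using assms(1) unfolding two_H_def by (auto simp: H_group_def)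
  then have "frag_cmul 2 c + d \<in> two_H #>\<^bsub>H_group\<^esub> d"
    by (auto simp: r_coset_def H_group_def)
  from repr_independence[OF this assms(2) subgroup_two_H] show ?thesis
    unfolding phi_def by simp
qed

lemma z_o_H_move:
  fixes u v :: "'a::infinite list"
  assumes "H_move UNIV u v" "gauss_word u" "gauss_word v"
  shows "z_o u = z_o v"
  using assms
proof (induction rule: H_move.induct)
  case (H1 A x y)
  then show ?case
    by (simp add: z_o_def h_H1 del: append.simps)
next
  case (H2 A B x y z)
  have "doubled UNIV (y @ x @ z) = doubled UNIV (x @ y @ z)"
    unfolding doubled_def by (simp only: count_list_append add.left_commute)
  with H2(4) have "gauss_phrase (y, x @ z)" "gauss_phrase ([], x @ y @ z)"
    by (simp_all add: gauss_phrase_def gauss_word_iff_doubled)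
  then have "frag_of (mixed_class (y, x @ z)) - frag_of (t_m (x @ y @ z)) \<in> carrier H_group"
    using keys_diff[of "frag_of (mixed_class (y, x @ z))" "frag_of (t_m (x @ y @ z))"]
    by (auto simp: H_group_def t_m_def GPM2_def mixed_class_def intro!: quotientI)
  then show ?case
    using H2 phi_add_double h_in_H_group[of "x @ y @ z"] unfolding z_o_def
    by (subst h_H2) auto
next
  case (H3 A B C x y z t)
  then show ?case
    unfolding z_o_def by (metis h_H3)
qed

theorem theorem6p1:
  fixes w1 w2 :: "'a::infinite list"
  assumes "gauss_word w1" and "gauss_word w2" and "open_homotopic w1 w2"
  shows "z_o w1 = z_o w2"
proof -
  have step_invariant: "z_o u = z_o v" if "open_step u v" for u v :: "'a list"
    using that z_o_H_move h_word_iso unfolding open_step_def z_o_def by metis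
  have "equivclp open_step w1 w2"
    using assms(3) by (simp add: open_homotopic_def)
  then show ?thesis
  proof (induction rule: equivclp_induct)
    case (step v v')
    then show ?case
      using step_invariant by metis
  qed simp
qed

end
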